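(* Let $H$ be a graph with $o(H)=\mathcal{N}$ and let $G$ be a graph with $n(G)\geq 2$. Then $$1+\left\lfloor \tfrac{n(G)-1}{2}\right\rfloor\gamma(H)+\left\lfloor \tfrac{n(G)}{2}\right\rfloor\gamma_{\mathrm{MB}}(H)\le\gamma_{\mathrm{MB}}(G\odot H)\le 1+(n(G)-1)\gamma_{\mathrm{MB}}(H)$$ and $$\left\lfloor \tfrac{n(G)}{2}\right\rfloor\gamma(H)+\left\lceil \tfrac{n(G)}{2}\right\rceil\gamma_{\mathrm{MB}}(H)\le\gamma_{\mathrm{MB}}'(G\odot H)\le n(G)\gamma_{\mathrm{MB}}(H).$$
   Context: All graphs are finite and simple; $n(G)$ denotes the order of $G$ and $\gamma(H)$ the domination number of $H$. The Maker-Breaker domination game on a graph $G$: Dominator and Staller alternately select a not yet selected vertex of $G$. Dominator wins if his selected vertices contain a dominating set of $G$; Staller wins if she selects at least one vertex from every dominating set of $G$. In the D-game Dominator moves first, in the S-game Staller moves first. $\gamma_{\mathrm{MB}}(G)$ (resp. $\gamma_{\mathrm{MB}}'(G)$) is the minimum number of moves Dominator needs to win the D-game (resp. S-game) on $G$ when both players play optimally, and is $\infty$ if Dominator has no winning strategy. The outcome $o(H)=\mathcal{N}$ means that in each of the D-game and the S-game on $H$ the player who moves first has a winning strategy. The corona $G\odot H$ is obtained from one copy of $G$ and $n(G)$ disjoint copies of $H$ by joining the $i$-th vertex of $G$ to every vertex of the $i$-th copy of $H$. *)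

theory Defs
  imports "Graph_Theory.Pair_Digraph" "HOL-Library.Extended_Nat"
begin

text \<open>Finite simple graphs are the symmetric loop-free finite digraphs of locale
  \<^locale>\<open>pair_graph\<close>: an edge is a pair of opposite arcs.\<close>

definition order :: "'a pair_pre_digraph \<Rightarrow> nat" where
  "order G = card (pverts G)"

definition dominating_set :: "'a pair_pre_digraph \<Rightarrow> 'a set \<Rightarrow> bool" where
  "dominating_set G X \<longleftrightarrow>
     X \<subseteq> pverts G \<and> (\<forall>v \<in> pverts G - X. \<exists>u \<in> X. (u, v) \<in> parcs G)"

definition domination_number :: "'a pair_pre_digraph \<Rightarrow> nat" where
  "domination_number G = (LEAST k. \<exists>X. dominating_set G X \<and> card X = k)"

text \<open>The copies of \<open>H\<close> are indexed by the vertices of \<open>G\<close>: \<open>Inl g\<close> is the vertex \<open>g\<close> of \<open>G\<close>,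
  and \<open>Inr (g, h)\<close> is the vertex \<open>h\<close> of the copy of \<open>H\<close> attached to \<open>g\<close>.\<close>

definition corona ::
    "'a pair_pre_digraph \<Rightarrow> 'b pair_pre_digraph \<Rightarrow> ('a + 'a \<times> 'b) pair_pre_digraph" where
  "corona G H =
     \<lparr> pverts = Inl ` pverts G \<union> Inr ` (pverts G \<times> pverts H),
       parcs = {(Inl g, Inl g') | g g'. (g, g') \<in> parcs G}
             \<union> {(Inr (g, h), Inr (g, h')) | g h h'. g \<in> pverts G \<and> (h, h') \<in> parcs H}
             \<union> {(Inl g, Inr (g, h)) | g h. g \<in> pverts G \<and> h \<in> pverts H}
             \<union> {(Inr (g, h), Inl g) | g h. g \<in> pverts G \<and> h \<in> pverts H} \<rparr>"

lemma pair_graph_corona: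
  assumes "pair_graph G" and "pair_graph H"
  shows "pair_graph (corona G H)"
proof -
  interpret G: pair_graph G by fact
  interpret H: pair_graph H by fact
  have fin: "finite (pverts (corona G H))"
    using G.pair_finite_verts H.pair_finite_verts by (simp add: corona_def)
  have sub: "parcs (corona G H) \<subseteq> pverts (corona G H) \<times> pverts (corona G H)"
    by (auto simp: corona_def dest: G.wellformed' H.wellformed')
  show ?thesis
  proof unfold_locales
    show "finite (pverts (corona G H))" by (fact fin)
    show "finite (parcs (corona G H))"
      using fin sub by (meson finite_SigmaI finite_subset)
    show "symmetric (with_proj (corona G H))"
      unfolding symmetric_def
      by (rule symI) (auto simp: corona_def dest: G.arcs_symmetric H.arcs_symmetric)
    fix e assume e: "e \<in> parcs (corona G H)"
    show "fst e \<in> pverts (corona G H)" "snd e \<in> pverts (corona G H)"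
      using e sub by auto
    show "fst e \<noteq> snd e"
      using e by (auto simp: corona_def dest: G.no_loops' H.no_loops')
  qed
qed

datatype player = Dominator | Staller

fun opponent :: "player \<Rightarrow> player" where
  "opponent Dominator = Staller"
| "opponent Staller = Dominator"

text \<open>A history is the list of the vertices selected so far, in the order of selection. The move
  with index \<open>i\<close> is made by \<open>to_move f i\<close>, where \<open>f\<close> is the player who starts: the D-game is
  \<open>f = Dominator\<close>, the S-game is \<open>f = Staller\<close>.\<close>

definition to_move :: "player \<Rightarrow> nat \<Rightarrow> player" where
  "to_move f i = (if even i then f else opponent f)"

definition selected :: "player \<Rightarrow> player \<Rightarrow> 'a list \<Rightarrow> 'a set" where
  "selected f p xs = {xs ! i | i. i < length xs \<and> to_move f i = p}"

text \<open>Plays are continued until all vertices are selected. This changes neither the winner nor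
  the number of moves after which Dominator has won.\<close>

definition play :: "'a pair_pre_digraph \<Rightarrow> 'a list \<Rightarrow> bool" where
  "play G xs \<longleftrightarrow> distinct xs \<and> set xs = pverts G"

definition strategy :: "'a pair_pre_digraph \<Rightarrow> ('a list \<Rightarrow> 'a) \<Rightarrow> bool" where
  "strategy G \<sigma> \<longleftrightarrow>
     (\<forall>xs. distinct xs \<and> set xs \<subset> pverts G \<longrightarrow> \<sigma> xs \<in> pverts G - set xs)"

definition follows :: "player \<Rightarrow> player \<Rightarrow> ('a list \<Rightarrow> 'a) \<Rightarrow> 'a list \<Rightarrow> bool" where
  "follows f p \<sigma> xs \<longleftrightarrow>
     (\<forall>i < length xs. to_move f i = p \<longrightarrow> xs ! i = \<sigma> (take i xs))"

fun wins :: "'a pair_pre_digraph \<Rightarrow> player \<Rightarrow> player \<Rightarrow> 'a list \<Rightarrow> bool" where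
  "wins G f Dominator xs \<longleftrightarrow> (\<exists>X. dominating_set G X \<and> X \<subseteq> selected f Dominator xs)"
| "wins G f Staller xs \<longleftrightarrow> (\<forall>X. dominating_set G X \<longrightarrow> X \<inter> selected f Staller xs \<noteq> {})"

definition has_winning_strategy :: "'a pair_pre_digraph \<Rightarrow> player \<Rightarrow> player \<Rightarrow> bool" where
  "has_winning_strategy G f p \<longleftrightarrow>
     (\<exists>\<sigma>. strategy G \<sigma> \<and> (\<forall>xs. play G xs \<and> follows f p \<sigma> xs \<longrightarrow> wins G f p xs))"

definition outcome_N :: "'a pair_pre_digraph \<Rightarrow> bool" where
  "outcome_N G \<longleftrightarrow>
     has_winning_strategy G Dominator Dominator \<and> has_winning_strategy G Staller Staller"

text \<open>Some strategy makes Dominator win after at most \<open>k\<close> moves of his own, whatever Staller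
  does; the moves of Staller are not counted.\<close>

definition wins_within :: "'a pair_pre_digraph \<Rightarrow> player \<Rightarrow> nat \<Rightarrow> bool" where
  "wins_within G f k \<longleftrightarrow>
     (\<exists>\<sigma>. strategy G \<sigma> \<and>
        (\<forall>xs. play G xs \<and> follows f Dominator \<sigma> xs \<longrightarrow>
           (\<exists>m. wins G f Dominator (take m xs) \<and>
                card (selected f Dominator (take m xs)) \<le> k)))"

text \<open>The infimum of the empty set in \<^typ>\<open>enat\<close> is \<open>\<infinity>\<close>.\<close>

definition gamma_MB :: "'a pair_pre_digraph \<Rightarrow> enat" where
  "gamma_MB G = Inf {enat k | k. wins_within G Dominator k}"

definition gamma_MB' :: "'a pair_pre_digraph \<Rightarrow> enat" where
  "gamma_MB' G = Inf {enat k | k. wins_within G Staller k}"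

end

theory Submission
  imports Defs
begin

text \<open>Dominator wins on the corona iff in each unit, consisting of a vertex \<open>g\<close> of \<open>G\<close> and its copy
  of \<open>H\<close>, he selects \<open>g\<close> or a dominating set of the copy. The game is thus a sum of games on
  disjoint boards. For the upper bounds Dominator answers each move of Staller in the same unit: he
  takes \<open>g\<close> if it is free, and otherwise follows an optimal strategy for the D-game on the copy; a
  move left over in a finished unit is spent usefully in another one.

  For the lower bounds Staller first takes all the vertices \<open>g\<close>, except in the unit where
  Dominator made his first move of the D-game. Dominator must answer each of them in the attached
  copy, since Staller wins the S-game there. Then all copies are in the position after the first
  move of a D-game with Staller to move. She alternates with Dominator in bringing copies to a
  position where she has replied, and from then on answers in the copy in which Dominator plays. So
  Dominator saves moves in at most half of the copies, and even there he needs \<open>\<gamma>(H)\<close> moves.\<close>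

section \<open>Sums of positional games\<close>

text \<open>\<open>D\<close> and \<open>S\<close> are the vertices selected so far. Staller is allowed to pass: this never helps her,
  and it makes the analysis of sums insensitive to moves in other components. Only the moves of
  Dominator count towards \<open>k\<close>.\<close>

definition replies :: "'v set \<Rightarrow> 'v set \<Rightarrow> 'v set \<Rightarrow> 'v set set" where
  "replies V D S = insert S ((\<lambda>u. insert u S) ` (V - D - S))"

primrec first_within :: "'v set \<Rightarrow> ('v set \<Rightarrow> bool) \<Rightarrow> nat \<Rightarrow> 'v set \<Rightarrow> 'v set \<Rightarrow> bool" where
  "first_within V W 0 D S \<longleftrightarrow> W D"
| "first_within V W (Suc k) D S \<longleftrightarrow> W D \<or>
     (\<exists>v \<in> V - D - S. \<forall>S' \<in> replies V (insert v D) S. first_within V W k (insert v D) S')"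

definition second_within :: "'v set \<Rightarrow> ('v set \<Rightarrow> bool) \<Rightarrow> nat \<Rightarrow> 'v set \<Rightarrow> 'v set \<Rightarrow> bool" where
  "second_within V W k D S \<longleftrightarrow> (\<forall>S' \<in> replies V D S. first_within V W k D S')"

section \<open>Positions on one board: monotonicity, witnesses and change of board\<close>

lemma first_within_Suc:
  "first_within V W (Suc k) D S \<longleftrightarrow>
     W D \<or> (\<exists>v \<in> V - D - S. second_within V W k (insert v D) S)"
  by (simp add: second_within_def)

lemma first_within_won: "W D \<Longrightarrow> first_within V W k D S"
  by (cases k) auto

lemma second_within_won: "W D \<Longrightarrow> second_within V W k D S"
  by (simp add: second_within_def first_within_won)

lemma second_imp_first: "second_within V W k D S \<Longrightarrow> first_within V W k D S"
  by (simp add: second_within_def replies_def)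

lemma second_within_iff:
  "second_within V W k D S \<longleftrightarrow>
     first_within V W k D S \<and> (\<forall>u \<in> V - D - S. first_within V W k D (insert u S))"
  by (auto simp: second_within_def replies_def)

lemma first_within_mono:
  assumes "first_within V W k D S" and "k \<le> l"
  shows "first_within V W l D S"
  using assms
proof (induction k arbitrary: l D S)
  case 0
  then show ?case by (simp add: first_within_won)
next
  case (Suc k)
  then obtain l' where l: "l = Suc l'" "k \<le> l'"
    by (cases l) auto
  show ?case
    using Suc.prems(1) Suc.IH[OF _ l(2)] unfolding l first_within.simps(2) by blast
qed

text \<open>Dominator keeps his moves. A reply of Staller that lies in \<open>S\<close> but not in
  \<open>S'\<close> is matched by a pass against the larger set \<open>S\<close>; here the pass in
  \<open>replies\<close> is used.\<close>

lemma first_within_antimono: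
  assumes "first_within V W k D S" and "S' \<subseteq> S"
  shows "first_within V W k D S'"
  using assms
proof (induction k arbitrary: D S S')
  case 0
  then show ?case by simp
next
  case (Suc k)
  show ?case
  proof (cases "W D")
    case False
    with Suc.prems obtain v where v: "v \<in> V - D - S"
      and second: "second_within V W k (insert v D) S"
      by (auto simp: second_within_def)
    have "first_within V W k (insert v D) T'" if "T' \<in> replies V (insert v D) S'" for T'
    proof -
      from that Suc.prems(2) obtain T where "T \<in> replies V (insert v D) S" "T' \<subseteq> T"
        unfolding replies_def by blast
      with second show ?thesis
        using Suc.IH by (auto simp: second_within_def)
    qed
    moreover have "v \<in> V - D - S'"
      using v Suc.prems(2) by auto
    ultimately show ?thesis
      by (auto simp: first_within.simps(2))
  qed (simp add: first_within_won)
qed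

text \<open>If Staller always passes, the moves that Dominator makes form the set \<open>X\<close>.
  This turns bounds on the size of winning sets into bounds on the number of moves.\<close>

lemma first_within_witness:
  assumes "first_within V W k D S"
  shows "\<exists>X \<subseteq> V - S. finite X \<and> card X \<le> k \<and> W (D \<union> X)"
  using assms
proof (induction k arbitrary: D)
  case 0
  then show ?case by (intro exI[of _ "{}"]) auto
next
  case (Suc k)
  show ?case
  proof (cases "W D")
    case True
    then show ?thesis by (intro exI[of _ "{}"]) auto
  next
    case False
    with Suc.prems obtain v where v: "v \<in> V - D - S"
      and "first_within V W k (insert v D) S"
      by (auto simp: replies_def)
    from Suc.IH[OF this(2)] obtain X
      where X: "X \<subseteq> V - S" "finite X" "card X \<le> k" "W (insert v D \<union> X)"
      by blast
    show ?thesis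
      using v X by (intro exI[of _ "insert v X"]) (auto simp: card_insert_if)
  qed
qed

text \<open>Outside the image of \<open>e\<close> every vertex is already taken, and Dominator's
  share there is frozen as \<open>D\<^sub>0\<close>. So play is confined to the image. The identity
  map yields a congruence rule; the embedding of a copy of \<open>H\<close> removes a vertex of
  \<open>G\<close> taken by Staller.\<close>

lemma first_within_transfer:
  assumes inj: "inj_on e V'" and sub: "e ` V' \<subseteq> V"
    and won: "\<And>D D'. D - e ` V' = D\<^sub>0 \<Longrightarrow> \<forall>x \<in> V'. e x \<in> D \<longleftrightarrow> x \<in> D' \<Longrightarrow> W D \<longleftrightarrow> W' D'"
  assumes "D - e ` V' = D\<^sub>0" and "V - e ` V' \<subseteq> D\<^sub>0 \<union> S"
    and "\<forall>x \<in> V'. e x \<in> D \<longleftrightarrow> x \<in> D'" and "\<forall>x \<in> V'. e x \<in> S \<longleftrightarrow> x \<in> S'"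
  shows "first_within V W k D S \<longleftrightarrow> first_within V' W' k D' S'"
  using assms(4-)
proof (induction k arbitrary: D D' S S')
  case 0
  then show ?case using won by simp
next
  case (Suc k)
  have free: "V - D - S = e ` (V' - D' - S')"
    using Suc.prems sub by blast
  have "(\<forall>T \<in> replies V (insert (e x) D) S. first_within V W k (insert (e x) D) T)
      \<longleftrightarrow> (\<forall>T' \<in> replies V' (insert x D') S'. first_within V' W' k (insert x D') T')"
    if x: "x \<in> V' - D' - S'" for x
  proof -
    have D: "insert (e x) D - e ` V' = D\<^sub>0"
      using x Suc.prems(1) by blast
    have D': "\<forall>y \<in> V'. e y \<in> insert (e x) D \<longleftrightarrow> y \<in> insert x D'"
      using x inj Suc.prems(3) by (auto dest: inj_onD)
    have free: "V - insert (e x) D - S = e ` (V' - insert x D' - S')"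
      using free D' x inj by (auto dest: inj_onD)
    have "first_within V W k (insert (e x) D) S \<longleftrightarrow> first_within V' W' k (insert x D') S'"
      using Suc.IH[OF D _ D'] Suc.prems(2,4) by blast
    moreover have "first_within V W k (insert (e x) D) (insert (e u) S)
        \<longleftrightarrow> first_within V' W' k (insert x D') (insert u S')"
      if u: "u \<in> V' - insert x D' - S'" for u
    proof (rule Suc.IH[OF D _ D'])
      show "V - e ` V' \<subseteq> D\<^sub>0 \<union> insert (e u) S"
        using Suc.prems(2) by blast
      show "\<forall>y \<in> V'. e y \<in> insert (e u) S \<longleftrightarrow> y \<in> insert u S'"
        using u inj Suc.prems(4) by (auto dest: inj_onD)
    qed
    ultimately show ?thesis
      unfolding replies_def free by simp
  qed
  moreover have "W D \<longleftrightarrow> W' D'"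
    using won Suc.prems by blast
  ultimately show ?case
    unfolding first_within.simps(2) free by simp
qed

section \<open>Local winning conditions and restriction to one component\<close>

definition local_to :: "'v set \<Rightarrow> ('v set \<Rightarrow> bool) \<Rightarrow> bool" where
  "local_to V W \<longleftrightarrow> (\<forall>D D'. D \<inter> V = D' \<inter> V \<longrightarrow> W D = W D')"

lemma first_within_cong:
  assumes "local_to V W" and "D \<inter> V = D' \<inter> V" and "S \<inter> V = S' \<inter> V"
  shows "first_within V W k D S \<longleftrightarrow> first_within V W k D' S'"
proof (rule first_within_transfer[where e = "\<lambda>x. x" and D\<^sub>0 = "D - V"])
  show "W A \<longleftrightarrow> W A'" if "\<forall>x \<in> V. x \<in> A \<longleftrightarrow> x \<in> A'" for A A'
    using assms(1) that unfolding local_to_def by blast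
qed (use assms in auto)

lemma second_within_cong:
  assumes "local_to V W" and "D \<inter> V = D' \<inter> V" and "S \<inter> V = S' \<inter> V"
  shows "second_within V W k D S \<longleftrightarrow> second_within V W k D' S'"
proof -
  have "V - D - S = V - D' - S'"
    using assms(2,3) by blast
  moreover have "first_within V W k D (insert u S) \<longleftrightarrow> first_within V W k D' (insert u S')" for u
    by (rule first_within_cong[OF assms(1)]) (use assms(2,3) in auto)
  ultimately show ?thesis
    unfolding second_within_iff using first_within_cong[OF assms] by simp
qed

lemma replies_mono: "B \<subseteq> V \<Longrightarrow> replies B D S \<subseteq> replies V D S"
  by (auto simp: replies_def)

lemma replies_Int_disjoint:
  "S' \<in> replies B D S \<Longrightarrow> B \<inter> B' = {} \<Longrightarrow> S' \<inter> B' = S \<inter> B'"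
  by (auto simp: replies_def)

text \<open>Staller confines herself to \<open>B\<close>, where her replies are also legal in
  \<open>V\<close>, and passes whenever Dominator plays elsewhere. His moves outside
  \<open>B\<close> only waste his budget.\<close>

lemma first_within_component:
  assumes "first_within V W k D S"
    and sub: "B \<subseteq> V" and won: "\<And>D. W D \<Longrightarrow> W' D" and loc: "local_to B W'"
  shows "first_within B W' k D S"
  using assms(1)
proof (induction k arbitrary: D S)
  case 0
  then show ?case using won by simp
next
  case (Suc k)
  show ?case
  proof (cases "W D")
    case True
    then show ?thesis using won by (simp add: first_within_won)
  next
    case False
    with Suc.prems obtain v where v: "v \<in> V - D - S"
      and second: "\<forall>S' \<in> replies V (insert v D) S. first_within V W k (insert v D) S'"
      by auto
    show ?thesis
    proof (cases "v \<in> B")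
      case True
      then show ?thesis
        using v second Suc.IH replies_mono[OF sub] unfolding first_within.simps(2) by blast
    next
      case False
      have "first_within B W' k (insert v D) S"
        using second Suc.IH by (simp add: replies_def)
      then have "first_within B W' k D S"
        using first_within_cong[OF loc, of "insert v D" D S S] False by auto
      then show ?thesis
        using first_within_mono le_Suc_eq by blast
    qed
  qed
qed

lemma second_within_component:
  assumes "second_within V W k D S"
    and "B \<subseteq> V" and "\<And>D. W D \<Longrightarrow> W' D" and "local_to B W'"
  shows "second_within B W' k D S"
  using assms(1) replies_mono[OF assms(2)] first_within_component[OF _ assms(2-)]
  unfolding second_within_def by blast

section \<open>Upper bounds for disjoint sums\<close>

text \<open>In \<open>j\<close> it is Dominator's turn; everywhere else he can afford that Staller
  moves next. His move makes all components safe in this sense, and her next move disturbs only one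
  of them. The induction is on the total budget.\<close>

lemma first_within_sum:
  fixes B :: "'i \<Rightarrow> 'v set"
  assumes fin: "finite I" and disj: "disjoint_family_on B I" and V: "V = (\<Union>i \<in> I. B i)"
    and won: "\<And>D. (\<And>i. i \<in> I \<Longrightarrow> W i D) \<Longrightarrow> W' D"
    and loc: "\<And>i. i \<in> I \<Longrightarrow> local_to (B i) (W i)"
  assumes "j \<in> I" and "first_within (B j) (W j) (k j) D S"
    and "\<And>i. i \<in> I - {j} \<Longrightarrow> second_within (B i) (W i) (k i) D S"
  shows "first_within V W' (sum k I) D S"
  using assms(6-)
proof (induction "sum k I" arbitrary: k j D S rule: less_induct)
  case less
  show ?case
  proof (cases "\<forall>i \<in> I. W i D")
    case True
    then show ?thesis using won by (simp add: first_within_won)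
  next
    case False
    \<comment> \<open>If component \<open>j\<close> is already won, the move is spare. It goes to a
      component not yet won, where moving first is at least as good as moving second.\<close>
    obtain i where i: "i \<in> I" "\<not> W i D" and second: "\<And>m. m \<in> I - {i} \<Longrightarrow> second_within (B m) (W m) (k m) D S"
      and first: "first_within (B i) (W i) (k i) D S"
    proof (cases "W j D")
      case True
      with False obtain i where i: "i \<in> I" "\<not> W i D" by blast
      then have "i \<noteq> j" using True by auto
      then have "second_within (B m) (W m) (k m) D S" if "m \<in> I" for m
        using that less.prems(3) True by (cases "m = j") (auto simp: second_within_won)
      then show ?thesis using that i by (blast intro: second_imp_first)
    next
      case False
      then show ?thesis using that less.prems by blast
    qed
    from first i(2) obtain l where l: "k i = Suc l"
      by (cases "k i") auto
    with first i(2) obtain v where v: "v \<in> B i - D - S"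
      and v_second: "second_within (B i) (W i) l (insert v D) S"
      by (auto simp: second_within_def)
    define k' where "k' = k(i := l)"
    have sum: "sum k I = Suc (sum k' I)"
      using fin i(1) l unfolding k'_def by (simp add: sum.remove)
    have second': "second_within (B m) (W m) (k' m) (insert v D) S" if m: "m \<in> I" for m
    proof (cases "m = i")
      case True
      then show ?thesis using v_second by (simp add: k'_def)
    next
      case False
      then have "v \<notin> B m"
        using disj m i(1) v unfolding disjoint_family_on_def by blast
      then show ?thesis
        using False second m second_within_cong[OF loc[OF m], of "insert v D" D S S]
        by (simp add: k'_def)
    qed
    \<comment> \<open>All components now tolerate a move of Staller. Her vertex \<open>u\<close>
      lies in a single \<open>B m\<close>, and \<open>m\<close> takes over the role of
      \<open>j\<close>; after a pass \<open>i\<close> does.\<close>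
    have "first_within V W' (sum k' I) (insert v D) S'" if "S' \<in> replies V (insert v D) S" for S'
    proof -
      consider "S' = S" | u where "u \<in> V - insert v D - S" "S' = insert u S"
        using \<open>S' \<in> _\<close> by (auto simp: replies_def)
      then show ?thesis
      proof cases
        case 1
        then show ?thesis
          using less.hyps[of k' i "insert v D" S] sum i(1) second' second_imp_first[OF second'] by auto
      next
        case 2
        then obtain m where m: "m \<in> I" "u \<in> B m" using V by blast
        show ?thesis
        proof (rule less.hyps[OF _ m(1)])
          show "sum k' I < sum k I" using sum by simp
          show "first_within (B m) (W m) (k' m) (insert v D) S'"
            using second'[OF m(1)] m(2) 2 by (simp add: second_within_iff)
          fix n assume n: "n \<in> I - {m}"
          then have "u \<notin> B n"
            using disj m unfolding disjoint_family_on_def by blast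
          then show "second_within (B n) (W n) (k' n) (insert v D) S'"
            using second'[of n] n 2 second_within_cong[OF loc, of n "insert v D" "insert v D" S' S] by auto
        qed
      qed
    qed
    moreover have "v \<in> V - D - S"
      using v V i(1) by blast
    ultimately show ?thesis
      unfolding sum by (auto simp: first_within.simps(2))
  qed
qed

lemma second_within_sum:
  fixes B :: "'i \<Rightarrow> 'v set"
  assumes "finite I" and "disjoint_family_on B I" and V: "V = (\<Union>i \<in> I. B i)"
    and "\<And>D. (\<And>i. i \<in> I \<Longrightarrow> W i D) \<Longrightarrow> W' D"
    and loc: "\<And>i. i \<in> I \<Longrightarrow> local_to (B i) (W i)"
    and "I \<noteq> {}" and second: "\<And>i. i \<in> I \<Longrightarrow> second_within (B i) (W i) (k i) D S"
  shows "second_within V W' (sum k I) D S"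
proof -
  have sum: "first_within V W' (sum k I) D S'"
    if "j \<in> I" "first_within (B j) (W j) (k j) D S'"
      "\<And>i. i \<in> I - {j} \<Longrightarrow> second_within (B i) (W i) (k i) D S'" for j S'
    by (rule first_within_sum[where B = B and W = W and j = j]) (fact assms that)+
  obtain i where "i \<in> I" using assms(6) by blast
  then have "first_within V W' (sum k I) D S"
    using sum[where j = i] second second_imp_first[OF second] by blast
  moreover have "first_within V W' (sum k I) D (insert u S)" if u: "u \<in> V - D - S" for u
  proof -
    obtain j where j: "j \<in> I" "u \<in> B j" using u V by blast
    show ?thesis
    proof (rule sum[OF j(1)])
      show "first_within (B j) (W j) (k j) D (insert u S)"
        using second[OF j(1)] u j(2) by (simp add: second_within_iff)
      fix n assume n: "n \<in> I - {j}"
      then have "u \<notin> B n"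
        using assms(2) j unfolding disjoint_family_on_def by blast
      then show "second_within (B n) (W n) (k n) D (insert u S)"
        using second[of n] n second_within_cong[OF loc, of n D D "insert u S" S] by auto
    qed
  qed
  ultimately show ?thesis by (simp add: second_within_iff)
qed

section \<open>Lower bounds for disjoint sums\<close>

text \<open>The bound concerns all budgets, but one reply serves them all: a reply that defeats the
  largest budget below \<open>r\<close> defeats the smaller ones by monotonicity.\<close>

lemma lower_bound_reply:
  assumes "\<And>k. second_within V W k D S \<Longrightarrow> r \<le> k"
  obtains S' where "S' \<in> replies V D S" and "\<And>k. first_within V W k D S' \<Longrightarrow> r \<le> k"
proof (cases r)
  case 0
  then show ?thesis using that[of S] by (simp add: replies_def)
next
  case (Suc q)
  then have "\<not> second_within V W q D S" using assms[of q] by auto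
  then obtain S' where S': "S' \<in> replies V D S" "\<not> first_within V W q D S'"
    by (auto simp: second_within_def)
  then have "r \<le> k" if "first_within V W k D S'" for k
    using that first_within_mono[of V W k D S' q] Suc by (meson not_less_eq_eq)
  then show ?thesis using that S'(1) by blast
qed

text \<open>In components of \<open>E\<close> Staller is due to move. Each move by which Dominator spoils one of
  them (so that it costs him only \<open>\<beta>\<close> moves) is answered by Staller's move in another one
  (which then costs \<open>\<alpha>\<close>).\<close>

lemma first_within_sum_lower:
  fixes B :: "'i \<Rightarrow> 'v set" and r :: "'i \<Rightarrow> nat"
  assumes fin: "finite I" and disj: "disjoint_family_on B I" and sub: "\<And>i. i \<in> I \<Longrightarrow> B i \<subseteq> V"
    and won: "\<And>D i. W' D \<Longrightarrow> i \<in> I \<Longrightarrow> W i D"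
    and loc: "\<And>i. i \<in> I \<Longrightarrow> local_to (B i) (W i)"
  assumes "first_within V W' k D S" and "A \<subseteq> I" and "E \<subseteq> I" and "A \<inter> E = {}"
    and "\<And>i m. i \<in> A \<Longrightarrow> first_within (B i) (W i) m D S \<Longrightarrow> r i \<le> m"
    and "\<And>i m. i \<in> E \<Longrightarrow> second_within (B i) (W i) m D S \<Longrightarrow> \<alpha> \<le> m"
    and "\<And>i X. i \<in> E \<Longrightarrow> X \<subseteq> B i - S \<Longrightarrow> finite X \<Longrightarrow> W i (D \<union> X) \<Longrightarrow> \<beta> \<le> card X"
  shows "sum r A + card E div 2 * \<alpha> + (card E + 1) div 2 * \<beta> \<le> k"
  using assms(6-)
\<comment> \<open>\<open>A\<close>, \<open>E\<close> and \<open>r\<close> vary because components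
  leave \<open>E\<close> for \<open>A\<close>, with their remaining cost recorded in
  \<open>r\<close>.\<close>
proof (induction k arbitrary: D S A E r)
  case 0
  \<comment> \<open>Without any move left, all components are already won, so all costs are
    zero.\<close>
  have "r i = 0" if "i \<in> A" for i
  proof -
    have "W i D" using won[of D i] 0(1,2) that by auto
    then show ?thesis using 0(5)[OF that, of 0] by simp
  qed
  moreover have "\<alpha> = 0 \<and> \<beta> = 0" if "i \<in> E" for i
  proof -
    have "W i D" using won[of D i] 0(1,3) that by auto
    then show ?thesis
      using 0(6)[OF that, of 0] 0(7)[OF that, of "{}"] by (simp add: second_within_won)
  qed
  ultimately show ?case
    by (cases "E = {}") auto
next
  case (Suc k)
  have finA: "finite A" and finE: "finite E"
    using fin Suc.prems finite_subset by auto
  have disj': "B i \<inter> B j = {}" if "i \<in> I" "j \<in> I" "i \<noteq> j" for i j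
    using disj that unfolding disjoint_family_on_def by blast
  show ?case
  proof (cases "W' D")
    case True
    then have "first_within V W' 0 D S" by simp
    then have "first_within V W' k D S" using first_within_mono by blast
    then have "sum r A + card E div 2 * \<alpha> + (card E + 1) div 2 * \<beta> \<le> k"
      by (rule Suc.IH) (fact Suc.prems(2-))+
    then show ?thesis by simp
  next
    case False
    with Suc.prems(1) obtain v where v: "v \<in> V - D - S"
      and second: "\<And>S'. S' \<in> replies V (insert v D) S \<Longrightarrow> first_within V W' k (insert v D) S'"
      by auto
    have keep_first: "r i \<le> m" if "i \<in> A" "v \<notin> B i" "S' \<inter> B i = S \<inter> B i"
      "first_within (B i) (W i) m (insert v D) S'" for i m S'
    proof -
      have "first_within (B i) (W i) m D S"
        using that first_within_cong[OF loc, of i "insert v D" D S' S] Suc.prems(2) by auto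
      then show ?thesis using Suc.prems(5) that(1) by blast
    qed
    have keep_second: "\<alpha> \<le> m" if "i \<in> E" "v \<notin> B i" "S' \<inter> B i = S \<inter> B i"
      "second_within (B i) (W i) m (insert v D) S'" for i m S'
    proof -
      have "second_within (B i) (W i) m D S"
        using that second_within_cong[OF loc, of i "insert v D" D S' S] Suc.prems(3) by auto
      then show ?thesis using Suc.prems(6) that(1) by blast
    qed
    have keep_card: "\<beta> \<le> card X" if "i \<in> E" "v \<notin> B i" "S' \<inter> B i = S \<inter> B i"
      "X \<subseteq> B i - S'" "finite X" "W i (insert v D \<union> X)" for i X S'
    proof -
      have "(insert v D \<union> X) \<inter> B i = (D \<union> X) \<inter> B i" using that(2) by blast
      then have "W i (D \<union> X)"
        using that(6) loc[of i] that(1) Suc.prems(3) unfolding local_to_def by blast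
      moreover have "X \<subseteq> B i - S" using that(3,4) by blast
      ultimately show ?thesis using Suc.prems(7) that(1,5) by blast
    qed
    have pass: "S \<in> replies V (insert v D) S" by (simp add: replies_def)
    consider (A) i where "i \<in> A" "v \<in> B i" | (E) i where "i \<in> E" "v \<in> B i"
      | (other) "\<forall>i \<in> A \<union> E. v \<notin> B i"
      by blast
    then show ?thesis
    proof cases
      case (A i)
      \<comment> \<open>One move of Dominator lowers the cost of component \<open>i\<close> by at
        most one, and Staller has a reply inside it that preserves the lowered bound.\<close>
      have step: "r i - 1 \<le> m" if "second_within (B i) (W i) m (insert v D) S" for m
      proof -
        have "first_within (B i) (W i) (Suc m) D S"
          using that v A(2) by (auto simp: first_within_Suc simp del: first_within.simps)
        then show ?thesis using Suc.prems(5) A(1) by fastforce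
      qed
      obtain S' where S': "S' \<in> replies (B i) (insert v D) S"
        and low: "\<And>m. first_within (B i) (W i) m (insert v D) S' \<Longrightarrow> r i - 1 \<le> m"
        using lower_bound_reply step by blast
      have iI: "i \<in> I" using A Suc.prems(2) by blast
      have other: "v \<notin> B j \<and> S' \<inter> B j = S \<inter> B j" if "j \<in> I" "j \<noteq> i" for j
        using disj'[OF iI that(1)] that(2) A(2) replies_Int_disjoint[OF S', of "B j"] by blast
      have "sum (r(i := r i - 1)) A + card E div 2 * \<alpha> + (card E + 1) div 2 * \<beta> \<le> k"
      proof (rule Suc.IH[of "insert v D" S'])
        show "first_within V W' k (insert v D) S'"
          using second S' replies_mono[OF sub[OF iI]] by blast
        show "A \<subseteq> I" "E \<subseteq> I" "A \<inter> E = {}" by fact+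
        show "(r(i := r i - 1)) j \<le> m"
          if "j \<in> A" "first_within (B j) (W j) m (insert v D) S'" for j m
          using that low keep_first[of j S'] other[of j] Suc.prems(2) by (cases "j = i") auto
        fix j assume j: "j \<in> E"
        then have "v \<notin> B j \<and> S' \<inter> B j = S \<inter> B j"
          using other[of j] A(1) Suc.prems(3,4) by blast
        then show "\<alpha> \<le> m" if "second_within (B j) (W j) m (insert v D) S'" for m
          using keep_second[OF j] that by blast
        show "\<beta> \<le> card X" if "X \<subseteq> B j - S'" "finite X" "W j (insert v D \<union> X)" for X
          using keep_card[OF j] that \<open>v \<notin> B j \<and> _\<close> by blast
      qed
      moreover have "sum r A \<le> Suc (sum (r(i := r i - 1)) A)"
        using finA A(1) by (simp add: sum.remove)
      ultimately show ?thesis by simp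
    next
      case (E i)
      have iI: "i \<in> I" and iA: "i \<notin> A" using E Suc.prems(3,4) by blast+
      \<comment> \<open>By \<open>first_within_witness\<close> a win within \<open>m\<close> moves
        gives a winning set of at most \<open>m\<close> further vertices; together with
        \<open>v\<close> it has at least \<open>\<beta>\<close> elements.\<close>
      have low: "\<beta> - 1 \<le> m" if "first_within (B i) (W i) m (insert v D) S" for m
      proof -
        from first_within_witness[OF that] obtain X
          where X: "X \<subseteq> B i - S" "finite X" "card X \<le> m" "W i (insert v D \<union> X)"
          by blast
        have "\<beta> \<le> card (insert v X)"
          using Suc.prems(7)[OF E(1), of "insert v X"] X v E(2) by auto
        also have "\<dots> \<le> Suc m" using X(2,3) by (simp add: card_insert_if)
        finally show ?thesis by simp
      qed
      show ?thesis
      proof (cases "E = {i}")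
        case True
        \<comment> \<open>Staller has no other component to move in and passes. \<open>i\<close>
          joins \<open>A\<close> at cost \<open>\<beta> - 1\<close>, which together with the move
          \<open>v\<close> pays for the summand \<open>\<beta>\<close> of a singleton
          \<open>E\<close>.\<close>
        have "sum (r(i := \<beta> - 1)) (insert i A) + card ({} :: 'i set) div 2 * \<alpha>
            + (card ({} :: 'i set) + 1) div 2 * \<beta> \<le> k"
        proof (rule Suc.IH[of "insert v D" S])
          show "first_within V W' k (insert v D) S" using second pass by blast
          show "insert i A \<subseteq> I" using iI Suc.prems(2) by blast
          fix j m assume j: "j \<in> insert i A" "first_within (B j) (W j) m (insert v D) S"
          show "(r(i := \<beta> - 1)) j \<le> m"
          proof (cases "j = i")
            case True
            then show ?thesis using j low by simp
          next
            case False
            then have "v \<notin> B j"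
              using disj'[OF iI, of j] j(1) E(2) Suc.prems(2) by blast
            then show ?thesis using False j keep_first[of j S] by auto
          qed
        qed auto
        moreover have "sum (r(i := \<beta> - 1)) A = sum r A"
          using iA by (intro sum.cong) auto
        ultimately show ?thesis
          using finA iA True by simp
      next
        case False
        then obtain j where j: "j \<in> E" "j \<noteq> i" using E(1) by blast
        have jI: "j \<in> I" and jA: "j \<notin> A" using j(1) Suc.prems(3,4) by blast+
        have vj: "v \<notin> B j" using disj'[OF iI jI] j(2) E(2) by blast
        have step: "\<alpha> \<le> m" if "second_within (B j) (W j) m (insert v D) S" for m
          using keep_second[OF j(1) vj refl that] .
        obtain S' where S': "S' \<in> replies (B j) (insert v D) S"
          and lowj: "\<And>m. first_within (B j) (W j) m (insert v D) S' \<Longrightarrow> \<alpha> \<le> m"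
          using lower_bound_reply step by blast
        have other: "S' \<inter> B l = S \<inter> B l" if "l \<in> I" "l \<noteq> j" for l
          using disj'[OF jI that(1)] that(2) replies_Int_disjoint[OF S', of "B l"] by blast
        have other_v: "v \<notin> B l" if "l \<in> I" "l \<noteq> i" for l
          using disj'[OF iI that(1)] that(2) E(2) by blast
        let ?r = "r(i := \<beta> - 1, j := \<alpha>)"
        let ?E = "E - {i, j}"
        \<comment> \<open>In \<open>E\<close> the pair \<open>i\<close>, \<open>j\<close>
          contributes \<open>\<alpha> + \<beta>\<close>. In \<open>A\<close> it contributes
          \<open>\<alpha> + (\<beta> - 1)\<close>, and the move \<open>v\<close> makes up the
          difference.\<close>
        have "sum ?r (insert i (insert j A)) + card ?E div 2 * \<alpha> + (card ?E + 1) div 2 * \<beta> \<le> k"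
        proof (rule Suc.IH[of "insert v D" S'])
          show "first_within V W' k (insert v D) S'"
            using second S' replies_mono[OF sub[OF jI]] by blast
          show "insert i (insert j A) \<subseteq> I" "?E \<subseteq> I" "insert i (insert j A) \<inter> ?E = {}"
            using iI jI Suc.prems(2-4) by auto
          show "?r l \<le> m"
            if l: "l \<in> insert i (insert j A)" and first: "first_within (B l) (W l) m (insert v D) S'" for l m
          proof -
            consider "l = j" | "l = i" "l \<noteq> j" | "l \<in> A" "l \<noteq> i" "l \<noteq> j" using l by blast
            then show ?thesis
            proof cases
              case 1
              then show ?thesis using lowj first by simp
            next
              case 2
              have "first_within (B i) (W i) m (insert v D) S"
                using first 2 first_within_cong[OF loc[OF iI] refl other[OF iI], of m "insert v D"] by simp
              then show ?thesis using low 2 by simp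
            next
              case 3
              then have "l \<in> I" using Suc.prems(2) by blast
              then show ?thesis
                using keep_first[OF 3(1) other_v other first] 3 by simp
            qed
          qed
          fix l assume l: "l \<in> ?E"
          then have lE: "l \<in> E" and "l \<in> I" "l \<noteq> i" "l \<noteq> j" using Suc.prems(3) by auto
          then have v: "v \<notin> B l" and S: "S' \<inter> B l = S \<inter> B l"
            using other_v other by auto
          show "\<alpha> \<le> m" if "second_within (B l) (W l) m (insert v D) S'" for m
            using keep_second[OF lE v S that] .
          show "\<beta> \<le> card X" if "X \<subseteq> B l - S'" "finite X" "W l (insert v D \<union> X)" for X
            using keep_card[OF lE v S that] .
        qed
        moreover have "sum ?r A = sum r A"
          using iA jA by (intro sum.cong) auto
        moreover have "card E = Suc (Suc (card ?E))"
          using finE E(1) j by (metis card_Suc_Diff1 Diff_insert2 finite_Diff insertE insert_Diff)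
        ultimately show ?thesis
          using finA iA jA j(2) by simp
      qed
    next
      case other
      \<comment> \<open>A move outside the components of \<open>A\<close> and \<open>E\<close> is
        wasted, and Staller passes.\<close>
      have "sum r A + card E div 2 * \<alpha> + (card E + 1) div 2 * \<beta> \<le> k"
      proof (rule Suc.IH[of "insert v D" S])
        show "first_within V W' k (insert v D) S" using second pass by blast
        show "A \<subseteq> I" "E \<subseteq> I" "A \<inter> E = {}" by fact+
      qed (use other keep_first[OF _ _ refl] keep_second[OF _ _ refl] keep_card[OF _ _ refl] in blast)+
      then show ?thesis by simp
    qed
  qed
qed

text \<open>Staller fixes one component at cost \<open>\<alpha>\<close> before Dominator can spoil
  any; the others form the set \<open>E\<close> of \<open>first_within_sum_lower\<close>. This
  exchanges the two roundings.\<close>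

lemma second_within_sum_lower:
  fixes B :: "'i \<Rightarrow> 'v set"
  assumes fin: "finite I" and disj: "disjoint_family_on B I" and sub: "\<And>i. i \<in> I \<Longrightarrow> B i \<subseteq> V"
    and won: "\<And>D i. W' D \<Longrightarrow> i \<in> I \<Longrightarrow> W i D"
    and loc: "\<And>i. i \<in> I \<Longrightarrow> local_to (B i) (W i)"
    and second: "second_within V W' k D S"
    and \<alpha>: "\<And>i m. i \<in> I \<Longrightarrow> second_within (B i) (W i) m D S \<Longrightarrow> \<alpha> \<le> m"
    and \<beta>: "\<And>i X. i \<in> I \<Longrightarrow> X \<subseteq> B i - S \<Longrightarrow> finite X \<Longrightarrow> W i (D \<union> X) \<Longrightarrow> \<beta> \<le> card X"
  shows "(card I + 1) div 2 * \<alpha> + card I div 2 * \<beta> \<le> k"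
proof (cases "I = {}")
  case False
  then obtain j where j: "j \<in> I" by blast
  obtain S' where S': "S' \<in> replies (B j) D S"
    and low: "\<And>m. first_within (B j) (W j) m D S' \<Longrightarrow> \<alpha> \<le> m"
    using lower_bound_reply \<alpha>[OF j] by blast
  have other: "S' \<inter> B i = S \<inter> B i" if "i \<in> I - {j}" for i
    using disj j that replies_Int_disjoint[OF S', of "B i"] unfolding disjoint_family_on_def by blast
  have "(\<Sum>i\<in>{j}. \<alpha>) + card (I - {j}) div 2 * \<alpha> + (card (I - {j}) + 1) div 2 * \<beta> \<le> k"
  proof (rule first_within_sum_lower[where I = I and B = B and V = V and W = W and W' = W'])
    show "finite I" "disjoint_family_on B I" by fact+
    show "B i \<subseteq> V" "local_to (B i) (W i)" if "i \<in> I" for i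
      using that sub loc by auto
    show "W i D" if "W' D" "i \<in> I" for D i
      using that won by blast
    show "first_within V W' k D S'"
      using second S' replies_mono[OF sub[OF j]] unfolding second_within_def by blast
    show "\<alpha> \<le> m" if "i \<in> I - {j}" "second_within (B i) (W i) m D S'" for i m
      using that \<alpha>[of i m] second_within_cong[OF loc refl other, of i] by blast
    show "\<beta> \<le> card X" if "i \<in> I - {j}" "X \<subseteq> B i - S'" "finite X" "W i (D \<union> X)" for i X
      using that \<beta>[of i X] other[OF that(1)] by blast
  qed (use j low in auto)
  moreover have "card I = Suc (card (I - {j}))"
    using fin j by (metis card_Suc_Diff1)
  ultimately show ?thesis by simp
qed simp

section \<open>From strategies to positions\<close>

definition dominates :: "'a pair_pre_digraph \<Rightarrow> 'a set \<Rightarrow> bool" where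
  "dominates G D \<longleftrightarrow> (\<exists>X. dominating_set G X \<and> X \<subseteq> D)"

lemma dominates_mono: "dominates G D \<Longrightarrow> D \<subseteq> D' \<Longrightarrow> dominates G D'"
  unfolding dominates_def by blast

lemma dominates_Int: "dominates G (D \<inter> pverts G) \<longleftrightarrow> dominates G D"
  unfolding dominates_def dominating_set_def by blast

lemma local_to_dominates: "local_to (pverts G) (dominates G)"
  unfolding local_to_def using dominates_Int[of G] by metis

lemma selected_Nil [simp]: "selected f p [] = {}"
  by (simp add: selected_def)

lemma selected_append:
  "selected f p (xs @ [v]) =
     (if to_move f (length xs) = p then insert v (selected f p xs) else selected f p xs)"
proof -
  have "selected f p (xs @ [v]) =
      (\<lambda>i. (xs @ [v]) ! i) ` ({i. i < length xs \<and> to_move f i = p} \<union> {i. i = length xs \<and> to_move f i = p})"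
    unfolding selected_def by (auto simp: less_Suc_eq)
  also have "\<dots> = (!) xs ` {i. i < length xs \<and> to_move f i = p}
      \<union> (\<lambda>_. v) ` {i. i = length xs \<and> to_move f i = p}"
    unfolding image_Un by (intro arg_cong2[of _ _ _ _ "(\<union>)"] image_cong) (auto simp: nth_append)
  finally show ?thesis
    unfolding selected_def by (auto simp: image_def)
qed

lemma selected_take_mono: "m \<le> n \<Longrightarrow> selected f p (take m xs) \<subseteq> selected f p (take n xs)"
proof
  fix x assume mn: "m \<le> n" and "x \<in> selected f p (take m xs)"
  then obtain i where "i < length (take m xs)" "x = take m xs ! i" "to_move f i = p"
    unfolding selected_def by blast
  with mn have "i < length (take n xs)" "x = take n xs ! i" "to_move f i = p"
    by auto
  then show "x \<in> selected f p (take n xs)"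
    unfolding selected_def by blast
qed

lemma selected_Un: "selected f Dominator xs \<union> selected f Staller xs = set xs"
proof
  show "set xs \<subseteq> selected f Dominator xs \<union> selected f Staller xs"
  proof
    fix x assume "x \<in> set xs"
    then obtain i where "i < length xs" "x = xs ! i" by (auto simp: in_set_conv_nth)
    then show "x \<in> selected f Dominator xs \<union> selected f Staller xs"
      unfolding selected_def by (cases "to_move f i") auto
  qed
qed (auto simp: selected_def)

lemma selected_disjoint:
  "distinct xs \<Longrightarrow> selected f Dominator xs \<inter> selected f Staller xs = {}"
  unfolding selected_def by (auto simp: nth_eq_iff_index_eq)

lemma selected_subset: "selected f p xs \<subseteq> set xs"
  unfolding selected_def by auto

lemma free_vertices: "V - selected f Dominator xs - selected f Staller xs = V - set xs"
  using selected_Un[of f xs] by blast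

lemma to_move_Suc: "to_move f (Suc i) = opponent (to_move f i)"
  by (cases f) (auto simp: to_move_def)

lemma follows_append:
  "follows f p \<sigma> (xs @ [v]) \<longleftrightarrow>
     follows f p \<sigma> xs \<and> (to_move f (length xs) = p \<longrightarrow> v = \<sigma> xs)"
  by (auto simp: follows_def nth_append less_Suc_eq)

text \<open>\<open>strategy\<close> demands a free vertex at every unfinished position, whoever is
  to move, so \<open>\<rho>\<close> can move for both players until the board is full.\<close>

lemma complete_play:
  assumes "strategy G \<rho>" and "finite (pverts G)" and "distinct xs" and "set xs \<subseteq> pverts G"
  shows "\<exists>ys. play G (xs @ ys) \<and>
    (\<forall>i < length (xs @ ys). length xs \<le> i \<longrightarrow> (xs @ ys) ! i = \<rho> (take i (xs @ ys)))"
  using assms(3,4)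
proof (induction "card (pverts G - set xs)" arbitrary: xs rule: less_induct)
  case less
  show ?case
  proof (cases "set xs = pverts G")
    case True
    then show ?thesis using less.prems by (intro exI[of _ "[]"]) (simp add: play_def)
  next
    case False
    then have v: "\<rho> xs \<in> pverts G - set xs"
      using assms(1) less.prems unfolding strategy_def by blast
    have "card (pverts G - set (xs @ [\<rho> xs])) < card (pverts G - set xs)"
      by (rule psubset_card_mono) (use assms(2) v in auto)
    with less.hyps[of "xs @ [\<rho> xs]"] v less.prems obtain ys where
      "play G (xs @ \<rho> xs # ys)" and
      "\<forall>i < length (xs @ \<rho> xs # ys). Suc (length xs) \<le> i \<longrightarrow>
         (xs @ \<rho> xs # ys) ! i = \<rho> (take i (xs @ \<rho> xs # ys))"
      by auto
    moreover have "(xs @ \<rho> xs # ys) ! i = \<rho> (take i (xs @ \<rho> xs # ys))" if "i = length xs" for i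
      using that by simp
    ultimately show ?thesis
      by (metis le_antisym not_less_eq_eq)
  qed
qed

lemma complete_play_follows:
  assumes "strategy G \<sigma>" and "finite (pverts G)" and "distinct xs" and "set xs \<subseteq> pverts G"
    and "follows f p \<sigma> xs"
  obtains ys where "play G (xs @ ys)" and "follows f p \<sigma> (xs @ ys)"
proof -
  from complete_play[OF assms(1-4)] obtain ys where ys: "play G (xs @ ys)"
    "\<forall>i < length (xs @ ys). length xs \<le> i \<longrightarrow> (xs @ ys) ! i = \<sigma> (take i (xs @ ys))"
    by blast
  have "(xs @ ys) ! i = \<sigma> (take i (xs @ ys))"
    if "i < length (xs @ ys)" "to_move f i = p" for i
    using that ys(2) assms(5) by (cases "i < length xs") (auto simp: follows_def nth_append)
  then have "follows f p \<sigma> (xs @ ys)" unfolding follows_def by blast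
  with ys(1) that show ?thesis by blast
qed

section \<open>Translation between strategies and positions\<close>

definition position_within ::
    "'a pair_pre_digraph \<Rightarrow> player \<Rightarrow> nat \<Rightarrow> 'a list \<Rightarrow> bool" where
  "position_within G f k xs \<longleftrightarrow>
     (if to_move f (length xs) = Dominator then first_within else second_within)
       (pverts G) (dominates G) k (selected f Dominator xs) (selected f Staller xs)"

lemma wins_Dominator: "wins G f Dominator xs \<longleftrightarrow> dominates G (selected f Dominator xs)"
  by (simp add: dominates_def)

text \<open>Backward induction over the partial plays consistent with \<open>\<sigma>\<close>. The
  budget of a position is what the moves made so far leave of \<open>k\<close>.\<close>

lemma position_within_of_strategy:
  assumes strat: "strategy G \<sigma>" and fin: "finite (pverts G)"
    and win: "\<And>xs. play G xs \<Longrightarrow> follows f Dominator \<sigma> xs \<Longrightarrow>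
      \<exists>m. wins G f Dominator (take m xs) \<and> card (selected f Dominator (take m xs)) \<le> k"
  assumes "distinct xs" and "set xs \<subseteq> pverts G" and "follows f Dominator \<sigma> xs"
  shows "position_within G f (k - card (selected f Dominator xs)) xs"
  using assms(4-)
proof (induction "card (pverts G - set xs)" arbitrary: xs rule: less_induct)
  case less
  let ?D = "selected f Dominator xs" and ?S = "selected f Staller xs"
  show ?case
  proof (cases "dominates G ?D")
    case True
    then show ?thesis
      by (simp add: position_within_def first_within_won second_within_won)
  next
    case False
    \<comment> \<open>Dominator has not won at \<open>xs\<close>, so in any continuation he wins
      strictly later.\<close>
    have later: "m > length xs" if "dominates G (selected f Dominator (take m (xs @ ys)))" for m ys
    proof (rule ccontr)
      assume "\<not> m > length xs"
      then have "selected f Dominator (take m (xs @ ys)) \<subseteq> ?D"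
        using selected_take_mono[of m "length xs" f Dominator xs] by simp
      then show False using that False dominates_mono by blast
    qed
    have "set xs \<noteq> pverts G"
    proof
      assume "set xs = pverts G"
      then obtain m where "dominates G (selected f Dominator (take m xs))"
        using win[of xs] less.prems by (auto simp: play_def wins_Dominator simp del: wins.simps)
      moreover from this have "m > length xs" using later[of m "[]"] by simp
      ultimately show False using False by simp
    qed
    have IH: "position_within G f (k - card (selected f Dominator (xs @ [v]))) (xs @ [v])"
      if "v \<in> pverts G - set xs" "to_move f (length xs) = Dominator \<Longrightarrow> v = \<sigma> xs" for v
    proof (rule less.hyps)
      show "card (pverts G - set (xs @ [v])) < card (pverts G - set xs)"
        by (rule psubset_card_mono) (use fin that in auto)
    qed (use that less.prems in \<open>auto simp: follows_append\<close>)
    show ?thesis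
    proof (cases "to_move f (length xs)")
      case Dominator
      define v where "v = \<sigma> xs"
      have v: "v \<in> pverts G - set xs"
        using strat less.prems \<open>set xs \<noteq> pverts G\<close> unfolding strategy_def v_def by blast
      have D: "selected f Dominator (xs @ [v]) = insert v ?D"
        using Dominator by (simp add: selected_append)
      have vD: "v \<notin> ?D" and finD: "finite ?D"
        using v selected_subset[of f Dominator xs] finite_subset by auto
      \<comment> \<open>Truncated subtraction could hide an overspent budget. A completed play is
        won within \<open>k\<close> moves, and \<open>v\<close> is among them since the win comes
        after \<open>xs\<close>.\<close>
      obtain ys where ys: "play G ((xs @ [v]) @ ys)" "follows f Dominator \<sigma> ((xs @ [v]) @ ys)"
        using complete_play_follows[OF strat fin, of "xs @ [v]" f Dominator] less.prems v
        by (auto simp: follows_append v_def)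
      from win[OF this] obtain m where m: "dominates G (selected f Dominator (take m ((xs @ [v]) @ ys)))"
        "card (selected f Dominator (take m ((xs @ [v]) @ ys))) \<le> k"
        by (auto simp: wins_Dominator simp del: wins.simps)
      have "m > length xs" using later[of m "v # ys"] m(1) by simp
      then have "insert v ?D \<subseteq> selected f Dominator (take m ((xs @ [v]) @ ys))"
        using selected_take_mono[of "Suc (length xs)" m f Dominator "(xs @ [v]) @ ys"] D by simp
      moreover have "finite (selected f Dominator (take m ((xs @ [v]) @ ys)))"
        using selected_subset finite_subset by (metis List.finite_set)
      ultimately have "card (insert v ?D) \<le> k"
        using m(2) card_mono le_trans by blast
      then have k: "k - card ?D = Suc (k - card (insert v ?D))"
        using vD finD by simp
      have "second_within (pverts G) (dominates G) (k - card (insert v ?D)) (insert v ?D) ?S"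
        using IH[OF v] Dominator D
        by (simp add: position_within_def to_move_Suc selected_append v_def)
      then have "first_within (pverts G) (dominates G) (k - card ?D) ?D ?S"
        unfolding k first_within_Suc free_vertices using v by blast
      then show ?thesis using Dominator by (simp add: position_within_def)
    next
      case Staller
      have reply: "first_within (pverts G) (dominates G) (k - card ?D) ?D (insert u ?S)"
        if "u \<in> pverts G - set xs" for u
        using IH[OF that] Staller by (simp add: position_within_def to_move_Suc selected_append)
      \<comment> \<open>A pass is no move of the actual game. It is covered by a genuine move
        \<open>u\<close>, because fewer vertices of Staller cannot hurt Dominator.\<close>
      obtain u where "u \<in> pverts G - set xs"
        using \<open>set xs \<noteq> pverts G\<close> less.prems by blast
      then have "first_within (pverts G) (dominates G) (k - card ?D) ?D ?S"
        using reply first_within_antimono by (metis subset_insertI)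
      then show ?thesis
        using Staller reply by (simp add: position_within_def second_within_iff free_vertices)
    qed
  qed
qed

lemma strategy_of_position_within:
  assumes fin: "finite (pverts G)" and start: "position_within G f k []"
  shows "wins_within G f k"
proof -
  \<comment> \<open>A good move is one after which the remaining budget still suffices.
    \<open>\<sigma>\<close> makes one whenever possible and otherwise takes any free vertex, as
    \<open>strategy\<close> demands.\<close>
  define good where "good xs v \<longleftrightarrow> second_within (pverts G) (dominates G)
      (k - card (insert v (selected f Dominator xs)))
      (insert v (selected f Dominator xs)) (selected f Staller xs)" for xs v
  define \<sigma> where "\<sigma> xs = (SOME v. v \<in> pverts G - set xs \<and>
      ((\<exists>u \<in> pverts G - set xs. good xs u) \<longrightarrow> good xs v))" for xs
  have \<sigma>: "\<sigma> xs \<in> pverts G - set xs \<and> ((\<exists>u \<in> pverts G - set xs. good xs u) \<longrightarrow> good xs (\<sigma> xs))"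
    if "set xs \<subset> pverts G" for xs
    unfolding \<sigma>_def by (rule someI_ex) (use that in blast)
  have "\<exists>m. wins G f Dominator (take m xs) \<and> card (selected f Dominator (take m xs)) \<le> k"
    if xs: "play G xs" "follows f Dominator \<sigma> xs" for xs
  proof (rule ccontr)
    assume never: "\<not> ?thesis"
    let ?D = "\<lambda>i. selected f Dominator (take i xs)"
    have not_dom: "\<not> dominates G (?D i)" if "card (?D i) \<le> k" for i
      using never that by (auto simp: wins_Dominator simp del: wins.simps)
    \<comment> \<open>As long as he has not won, the budget is not overdrawn and what remains of it
      suffices.\<close>
    have "card (?D i) \<le> k \<and> position_within G f (k - card (?D i)) (take i xs)"
      if "i \<le> length xs" for i
      using that
    proof (induction i)
      case 0
      then show ?case using start by simp
    next
      case (Suc i)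
      let ?v = "xs ! i" and ?ys = "take i xs"
      from Suc have card: "card (?D i) \<le> k" and pos: "position_within G f (k - card (?D i)) ?ys"
        by auto
      have take: "take (Suc i) xs = ?ys @ [?v]" and len: "length ?ys = i"
        using Suc.prems by (auto simp: take_Suc_conv_app_nth)
      have "set (?ys @ [?v]) \<subseteq> pverts G" "distinct (?ys @ [?v])"
        using xs(1) take set_take_subset[of "Suc i" xs] unfolding play_def by (auto simp flip: take)
      then have v: "?v \<in> pverts G - set ?ys" and ys: "set ?ys \<subset> pverts G"
        by auto
      show ?case
      proof (cases "to_move f i")
        case Dominator
        then have first: "first_within (pverts G) (dominates G) (k - card (?D i)) (?D i) (selected f Staller ?ys)"
          using pos len by (simp add: position_within_def)
        with not_dom[OF card] obtain l where l: "k - card (?D i) = Suc l"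
          by (cases "k - card (?D i)") auto
        with first not_dom[OF card] obtain u where u: "u \<in> pverts G - set ?ys"
          and second: "second_within (pverts G) (dominates G) l (insert u (?D i)) (selected f Staller ?ys)"
          by (auto simp: first_within_Suc free_vertices simp del: first_within.simps)
        have card_insert: "card (insert w (?D i)) = Suc (card (?D i))" if "w \<in> pverts G - set ?ys" for w
        proof -
          have "w \<notin> ?D i" "finite (?D i)"
            using that selected_subset[of f Dominator ?ys] finite_subset by auto
          then show ?thesis by simp
        qed
        have "good ?ys u"
          using second l card_insert[OF u] unfolding good_def by (simp add: diff_Suc)
        moreover have "?v = \<sigma> ?ys"
          using xs(2) Dominator Suc.prems unfolding follows_def by simp
        ultimately have "good ?ys ?v" using \<sigma>[OF ys] u by auto
        then show ?thesis
          unfolding take using Dominator len l card_insert[OF v]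
          by (simp add: selected_append position_within_def to_move_Suc good_def)
      next
        case Staller
        then have "second_within (pverts G) (dominates G) (k - card (?D i)) (?D i) (selected f Staller ?ys)"
          using pos len by (simp add: position_within_def)
        then have "first_within (pverts G) (dominates G) (k - card (?D i)) (?D i) (insert ?v (selected f Staller ?ys))"
          using v by (simp add: second_within_iff free_vertices)
        then show ?thesis
          unfolding take using Staller len card
          by (simp add: selected_append position_within_def to_move_Suc)
      qed
    qed
    from this[of "length xs"] have card: "card (?D (length xs)) \<le> k"
      and "position_within G f (k - card (?D (length xs))) xs"
      by auto
    then have "first_within (pverts G) (dominates G) (k - card (?D (length xs)))
        (selected f Dominator xs) (selected f Staller xs)"
      by (auto simp: position_within_def intro: second_imp_first split: if_splits)
    \<comment> \<open>On a full board no move is left, so \<open>first_within\<close> can hold only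
      because Dominator has already won.\<close>
    moreover have "pverts G - selected f Dominator xs - selected f Staller xs = {}"
      using xs(1) by (simp add: free_vertices play_def)
    ultimately have "dominates G (selected f Dominator xs)"
      by (cases "k - card (?D (length xs))") auto
    then show False using not_dom[OF card] by simp
  qed
  moreover have "strategy G \<sigma>"
    unfolding strategy_def using \<sigma> by blast
  ultimately show ?thesis unfolding wins_within_def by blast
qed

lemma wins_within_iff:
  assumes "finite (pverts G)"
  shows "wins_within G f k \<longleftrightarrow> position_within G f k []"
proof
  assume "wins_within G f k"
  then obtain \<sigma> where \<sigma>: "strategy G \<sigma>" and win: "\<And>xs. play G xs \<Longrightarrow> follows f Dominator \<sigma> xs \<Longrightarrow>
      \<exists>m. wins G f Dominator (take m xs) \<and> card (selected f Dominator (take m xs)) \<le> k"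
    unfolding wins_within_def by blast
  have "position_within G f (k - card (selected f Dominator xs)) xs" if "xs = []" for xs
    by (rule position_within_of_strategy)
      (use \<sigma> assms win that in \<open>auto simp: follows_def simp del: wins.simps\<close>)
  then show "position_within G f k []" by simp
qed (rule strategy_of_position_within[OF assms])

lemma wins_within_Dominator_iff:
  "finite (pverts G) \<Longrightarrow>
     wins_within G Dominator k \<longleftrightarrow> first_within (pverts G) (dominates G) k {} {}"
  by (simp add: wins_within_iff position_within_def to_move_def)

lemma wins_within_Staller_iff:
  "finite (pverts G) \<Longrightarrow>
     wins_within G Staller k \<longleftrightarrow> second_within (pverts G) (dominates G) k {} {}"
  by (simp add: wins_within_iff position_within_def to_move_def)

text \<open>With all vertices as budget, counting moves is no restriction. This makes
  \<open>gamma_MB H\<close> finite.\<close>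

lemma wins_within_of_has_winning_strategy:
  assumes "finite (pverts G)" and "has_winning_strategy G f Dominator"
  shows "wins_within G f (card (pverts G))"
proof -
  obtain \<sigma> where \<sigma>: "strategy G \<sigma>"
    and win: "\<And>xs. play G xs \<Longrightarrow> follows f Dominator \<sigma> xs \<Longrightarrow> wins G f Dominator xs"
    using assms(2) unfolding has_winning_strategy_def by blast
  have "\<exists>m. wins G f Dominator (take m xs) \<and> card (selected f Dominator (take m xs)) \<le> card (pverts G)"
    if "play G xs" "follows f Dominator \<sigma> xs" for xs
    using win[OF that] that(1) selected_subset[of f Dominator xs]
    by (intro exI[of _ "length xs"])
      (auto simp: play_def simp del: wins.simps intro!: card_mono assms(1))
  with \<sigma> show ?thesis unfolding wins_within_def by blast
qed

text \<open>The two strategies are played against each other: Dominator would own a dominating set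
  that Staller has met.\<close>

lemma not_wins_within:
  assumes fin: "finite (pverts G)" and "has_winning_strategy G f Staller"
  shows "\<not> wins_within G f k"
proof
  assume "wins_within G f k"
  then obtain \<sigma> where \<sigma>: "strategy G \<sigma>" and Dom: "\<And>xs. play G xs \<Longrightarrow> follows f Dominator \<sigma> xs \<Longrightarrow>
      \<exists>m. wins G f Dominator (take m xs)"
    unfolding wins_within_def by blast
  obtain \<tau> where \<tau>: "strategy G \<tau>"
    and Stall: "\<And>xs. play G xs \<Longrightarrow> follows f Staller \<tau> xs \<Longrightarrow> wins G f Staller xs"
    using assms(2) unfolding has_winning_strategy_def by blast
  let ?\<rho> = "\<lambda>xs. if to_move f (length xs) = Dominator then \<sigma> xs else \<tau> xs"
  have "strategy G ?\<rho>" using \<sigma> \<tau> unfolding strategy_def by simp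
  from complete_play[OF this fin, of "[]"] obtain xs where xs: "play G xs"
    and \<rho>: "\<And>i. i < length xs \<Longrightarrow> xs ! i = ?\<rho> (take i xs)"
    by auto
  have "follows f Dominator \<sigma> xs" "follows f Staller \<tau> xs"
    using \<rho> by (auto simp: follows_def)
  then obtain m where m: "wins G f Dominator (take m xs)" and S: "wins G f Staller xs"
    using Dom Stall xs by blast
  then obtain X where "dominating_set G X" "X \<subseteq> selected f Dominator (take m xs)" by auto
  moreover have "selected f Dominator (take m xs) \<subseteq> selected f Dominator xs"
    using selected_take_mono[of m "max m (length xs)" f Dominator xs] by simp
  ultimately show False
    using S selected_disjoint[of xs f] xs unfolding play_def by fastforce
qed

section \<open>The corona\<close>

definition unit :: "'b pair_pre_digraph \<Rightarrow> 'a \<Rightarrow> ('a + 'a \<times> 'b) set" where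
  "unit H g = insert (Inl g) ((\<lambda>h. Inr (g, h)) ` pverts H)"

definition unit_won :: "'b pair_pre_digraph \<Rightarrow> 'a \<Rightarrow> ('a + 'a \<times> 'b) set \<Rightarrow> bool" where
  "unit_won H g D \<longleftrightarrow> Inl g \<in> D \<or> dominates H {h. Inr (g, h) \<in> D}"

lemma disjoint_units: "disjoint_family_on (unit H) I"
  by (auto simp: disjoint_family_on_def unit_def)

lemma pverts_corona: "pverts (corona G H) = (\<Union>g \<in> pverts G. unit H g)"
  by (auto simp: corona_def unit_def)

lemma local_to_unit_won: "local_to (unit H g) (unit_won H g)"
proof -
  have "unit_won H g D \<longleftrightarrow> unit_won H g D'" if "D \<inter> unit H g = D' \<inter> unit H g" for D D'
  proof -
    have "Inl g \<in> D \<longleftrightarrow> Inl g \<in> D'" "{h. Inr (g, h) \<in> D} \<inter> pverts H = {h. Inr (g, h) \<in> D'} \<inter> pverts H"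
      using that unfolding unit_def by blast+
    then show ?thesis
      unfolding unit_won_def using dominates_Int by metis
  qed
  then show ?thesis unfolding local_to_def by blast
qed

text \<open>The only vertex of the unit outside the copy belongs to Staller, so only the domination
  game on \<open>H\<close> remains.\<close>

lemma first_within_unit:
  assumes "Inl g \<in> S" and "Inl g \<notin> D"
  shows "first_within (unit H g) (unit_won H g) k D S \<longleftrightarrow>
    first_within (pverts H) (dominates H) k {h. Inr (g, h) \<in> D} {h. Inr (g, h) \<in> S}"
proof (rule first_within_transfer[where e = "\<lambda>h. Inr (g, h)"])
  show "D - (\<lambda>h. Inr (g, h)) ` pverts H = D - (\<lambda>h. Inr (g, h)) ` pverts H" ..
  fix A B
  assume A: "A - (\<lambda>h. Inr (g, h)) ` pverts H = D - (\<lambda>h. Inr (g, h)) ` pverts H"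
    and "\<forall>h \<in> pverts H. Inr (g, h) \<in> A \<longleftrightarrow> h \<in> B"
  then have "{h. Inr (g, h) \<in> A} \<inter> pverts H = B \<inter> pverts H" by auto
  moreover have "Inl g \<notin> A" using A assms(2) by blast
  ultimately show "unit_won H g A \<longleftrightarrow> dominates H B"
    unfolding unit_won_def by (metis dominates_Int)
qed (use assms in \<open>auto simp: unit_def inj_on_def\<close>)

lemma second_within_unit:
  assumes "Inl g \<in> S" and "Inl g \<notin> D"
    and "second_within (unit H g) (unit_won H g) k D S"
  shows "second_within (pverts H) (dominates H) k {h. Inr (g, h) \<in> D} {h. Inr (g, h) \<in> S}"
proof -
  have "first_within (pverts H) (dominates H) k {h. Inr (g, h) \<in> D} (insert u {h. Inr (g, h) \<in> S})"
    if "u \<in> pverts H - {h. Inr (g, h) \<in> D} - {h. Inr (g, h) \<in> S}" for u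
  proof -
    have "first_within (unit H g) (unit_won H g) k D (insert (Inr (g, u)) S)"
      using assms(3) that unfolding second_within_iff by (auto simp: unit_def)
    moreover have "{h. Inr (g, h) \<in> insert (Inr (g, u)) S} = insert u {h. Inr (g, h) \<in> S}"
      by auto
    ultimately show ?thesis
      using first_within_unit[of g "insert (Inr (g, u)) S" D H k] assms(1,2) by simp
  qed
  then show ?thesis
    using assms first_within_unit[OF assms(1,2)] unfolding second_within_iff by blast
qed

text \<open>A vertex of the copy at \<open>g\<close> has \<open>Inl g\<close> as its only neighbour
  outside the copy, so without \<open>Inl g\<close> the copy must be dominated from within.\<close>

lemma dominates_corona_iff:
  assumes "pverts H \<noteq> {}"
  shows "dominates (corona G H) D \<longleftrightarrow> (\<forall>g \<in> pverts G. unit_won H g D)"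
proof
  assume "dominates (corona G H) D"
  then obtain X where X: "dominating_set (corona G H) X" "X \<subseteq> D"
    unfolding dominates_def by blast
  show "\<forall>g \<in> pverts G. unit_won H g D"
  proof
    fix g assume g: "g \<in> pverts G"
    show "unit_won H g D"
    proof (cases "Inl g \<in> X")
      case True
      then show ?thesis using X(2) unfolding unit_won_def by blast
    next
      case False
      have "dominating_set H {h. Inr (g, h) \<in> X}"
        unfolding dominating_set_def
      proof (intro conjI ballI)
        show "{h. Inr (g, h) \<in> X} \<subseteq> pverts H"
          using X(1) unfolding dominating_set_def corona_def by auto
        fix h assume "h \<in> pverts H - {h. Inr (g, h) \<in> X}"
        then have "Inr (g, h) \<in> pverts (corona G H) - X"
          using g by (simp add: corona_def)
        then obtain u where "u \<in> X" "(u, Inr (g, h)) \<in> parcs (corona G H)"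
          using X(1) unfolding dominating_set_def by blast
        then show "\<exists>u \<in> {h. Inr (g, h) \<in> X}. (u, h) \<in> parcs H"
          using False by (auto simp: corona_def)
      qed
      then show ?thesis
        using X(2) unfolding unit_won_def dominates_def by blast
    qed
  qed
next
  assume won: "\<forall>g \<in> pverts G. unit_won H g D"
  have "dominating_set (corona G H) (D \<inter> pverts (corona G H))"
    unfolding dominating_set_def
  proof (intro conjI ballI)
    fix w assume w: "w \<in> pverts (corona G H) - D \<inter> pverts (corona G H)"
    then obtain g where g: "g \<in> pverts G" "w \<in> unit H g"
      by (auto simp: pverts_corona)
    show "\<exists>u \<in> D \<inter> pverts (corona G H). (u, w) \<in> parcs (corona G H)"
    proof (cases "Inl g \<in> D")
      case True
      then have "w \<noteq> Inl g" using w by auto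
      then obtain h where "h \<in> pverts H" "w = Inr (g, h)"
        using g(2) by (auto simp: unit_def)
      then show ?thesis
        using True g(1) by (intro bexI[of _ "Inl g"]) (auto simp: corona_def)
    next
      case False
      then obtain X where X: "dominating_set H X" "\<And>h. h \<in> X \<Longrightarrow> Inr (g, h) \<in> D"
        using won g(1) unfolding unit_won_def dominates_def by blast
      have XH: "X \<subseteq> pverts H" using X(1) unfolding dominating_set_def by blast
      show ?thesis
      proof (cases "w = Inl g")
        case True
        \<comment> \<open>As \<open>H\<close> is nonempty, its dominating set has an element, and
          this dominates \<open>Inl g\<close>.\<close>
        obtain h where "h \<in> X" using X(1) assms unfolding dominating_set_def by blast
        then show ?thesis
          using True g(1) X(2) XH by (intro bexI[of _ "Inr (g, h)"]) (auto simp: corona_def)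
      next
        case False
        then obtain h where h: "h \<in> pverts H" "w = Inr (g, h)"
          using g(2) by (auto simp: unit_def)
        then have "h \<notin> X" using w X(2) by auto
        then obtain h' where "h' \<in> X" "(h', h) \<in> parcs H"
          using X(1) h(1) unfolding dominating_set_def by blast
        then show ?thesis
          using h(2) g(1) X(2) XH by (intro bexI[of _ "Inr (g, h')"]) (auto simp: corona_def)
      qed
    qed
  qed auto
  then show "dominates (corona G H) D"
    unfolding dominates_def by blast
qed

section \<open>The domination number and bounds for untouched units\<close>

lemma domination_number_le:
  "dominating_set G X \<Longrightarrow> domination_number G \<le> card X"
  unfolding domination_number_def by (rule Least_le) blast

lemma domination_number_pos:
  assumes "finite (pverts G)" and "\<not> dominates G {}"
  shows "domination_number G \<ge> 1"
proof -
  have "dominating_set G (pverts G)" by (simp add: dominating_set_def)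
  then have "\<exists>X. dominating_set G X \<and> card X = domination_number G"
    using LeastI[of "\<lambda>k. \<exists>X. dominating_set G X \<and> card X = k" "card (pverts G)"]
    unfolding domination_number_def by blast
  then obtain X where X: "dominating_set G X" "card X = domination_number G" by blast
  then have "X \<noteq> {}" "finite X"
    using assms finite_subset unfolding dominates_def dominating_set_def by auto
  then show ?thesis using X(2) by (metis Suc_leI One_nat_def card_gt_0_iff)
qed

lemma first_within_unit_1:
  assumes "Inl g \<notin> S"
  shows "first_within (unit H g) (unit_won H g) 1 {} S"
proof -
  have "unit_won H g {Inl g}" by (simp add: unit_won_def)
  then have "second_within (unit H g) (unit_won H g) 0 {Inl g} S"
    by (rule second_within_won)
  then have "first_within (unit H g) (unit_won H g) (Suc 0) {} S"
    unfolding first_within_Suc using assms by (auto simp: unit_def)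
  then show ?thesis by simp
qed

text \<open>If Staller leaves \<open>Inl g\<close> free, Dominator takes it and has won the unit; if
  she takes it, he is the first to move on the copy.\<close>

lemma second_within_unit_upper:
  assumes "first_within (pverts H) (dominates H) a {} {}" and "a \<ge> 1"
  shows "second_within (unit H g) (unit_won H g) a {} {}"
proof -
  have "first_within (unit H g) (unit_won H g) a {} S" if "Inl g \<notin> S" for S
    using first_within_mono[OF first_within_unit_1[OF that] assms(2)] .
  moreover have "first_within (unit H g) (unit_won H g) a {} {Inl g}"
    using assms(1) first_within_unit[of g "{Inl g}" "{}" H a] by simp
  ultimately show ?thesis
    unfolding second_within_iff by (auto simp: unit_def)
qed

text \<open>Staller takes the vertices of \<open>G\<close> one after another. Dominator has to answer each of them in
  the attached copy of \<open>H\<close>, as otherwise Staller wins there by moving first.\<close>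

lemma second_within_corona_lower:
  fixes G :: "'a pair_pre_digraph" and H :: "'b pair_pre_digraph"
  assumes finH: "finite (pverts H)" and neH: "pverts H \<noteq> {}"
    and noS: "\<And>k. \<not> second_within (pverts H) (dominates H) k {} {}"
    and a: "\<And>k. first_within (pverts H) (dominates H) k {} {} \<Longrightarrow> a \<le> k"
  assumes "finite F" and "finite E" and "F \<inter> E = {}" and "F \<union> E \<subseteq> pverts G"
    and "second_within (pverts (corona G H)) (dominates (corona G H)) k D S"
    and "\<And>g. g \<in> F \<Longrightarrow> D \<inter> unit H g = {} \<and> S \<inter> unit H g = {}"
    and "\<And>g m. g \<in> E \<Longrightarrow> second_within (unit H g) (unit_won H g) m D S \<Longrightarrow> a - 1 \<le> m"
    and "\<And>g X. g \<in> E \<Longrightarrow> X \<subseteq> unit H g - S \<Longrightarrow> finite X \<Longrightarrow> unit_won H g (D \<union> X) \<Longrightarrow>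
      domination_number H - 1 \<le> card X"
  shows "card F + (card (F \<union> E) + 1) div 2 * (a - 1)
    + card (F \<union> E) div 2 * (domination_number H - 1) \<le> k"
  using assms(5-)
proof (induction F arbitrary: E D S k rule: finite_induct)
  case empty
  \<comment> \<open>No untouched unit is left. The costs are those that remain in a copy once the
    forced move there has been made.\<close>
  have "(card E + 1) div 2 * (a - 1) + card E div 2 * (domination_number H - 1) \<le> k"
  proof (rule second_within_sum_lower[where B = "unit H" and W = "unit_won H"])
    show "unit H g \<subseteq> pverts (corona G H)" if "g \<in> E" for g
      using that empty.prems(3) by (auto simp: pverts_corona)
    show "unit_won H g D" if "dominates (corona G H) D" "g \<in> E" for D g
      using that empty.prems(3) dominates_corona_iff[OF neH, of G D] by auto
    show "a - 1 \<le> m" if "g \<in> E" "second_within (unit H g) (unit_won H g) m D S" for g m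
      using that empty.prems(6) by blast
    show "domination_number H - 1 \<le> card X"
      if "g \<in> E" "X \<subseteq> unit H g - S" "finite X" "unit_won H g (D \<union> X)" for g X
      using that empty.prems(7) by blast
    show "finite E" "second_within (pverts (corona G H)) (dominates (corona G H)) k D S"
      by fact+
  qed (rule disjoint_units local_to_unit_won)+
  then show ?case by simp
next
  case (insert g F)
  let ?V = "pverts (corona G H)" and ?W = "dominates (corona G H)" and ?S = "insert (Inl g) S"
  have gG: "g \<in> pverts G" using insert.prems(3) by blast
  have fresh: "D \<inter> unit H g = {}" "S \<inter> unit H g = {}" using insert.prems(5)[of g] by auto
  then have Inl: "Inl g \<notin> D" "Inl g \<notin> S" and Inr: "\<And>h. h \<in> pverts H \<Longrightarrow> Inr (g, h) \<notin> D \<and> Inr (g, h) \<notin> S"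
    unfolding unit_def by auto
  have sub: "unit H g \<subseteq> ?V" using gG by (auto simp: pverts_corona)
  have won: "unit_won H g D" if "?W D" for D
    using that gG dominates_corona_iff[OF neH, of G D] by simp
  have "\<not> dominates H {}" using noS second_within_won by blast
  moreover have "{h. Inr (g, h) \<in> D} \<inter> pverts H = {}" using Inr by blast
  ultimately have "\<not> unit_won H g D"
    using Inl dominates_Int[of H "{h. Inr (g, h) \<in> D}"] by (simp add: unit_won_def)
  then have "\<not> ?W D" using won by blast
  \<comment> \<open>Staller takes \<open>Inl g\<close>. The corona is not yet dominated, so
    Dominator must have a move left.\<close>
  moreover have "first_within ?V ?W k D ?S"
    using insert.prems(4) Inl gG unfolding second_within_iff by (auto simp: corona_def)
  ultimately obtain k' v where k: "k = Suc k'" and v: "v \<in> ?V - D - ?S"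
    and second: "second_within ?V ?W k' (insert v D) ?S"
    by (cases k) (auto simp: first_within_Suc simp del: first_within.simps(2))
  have copy: "second_within (pverts H) (dominates H) m ({h. Inr (g, h) = v} \<inter> pverts H) {}"
    if "second_within (unit H g) (unit_won H g) m (insert v D) ?S" for m
  proof -
    have "second_within (pverts H) (dominates H) m {h. Inr (g, h) \<in> insert v D} {h. Inr (g, h) \<in> ?S}"
      by (rule second_within_unit[OF _ _ that]) (use v Inl in auto)
    moreover have "{h. Inr (g, h) \<in> insert v D} \<inter> pverts H
        = ({h. Inr (g, h) = v} \<inter> pverts H) \<inter> pverts H"
      using Inr by auto
    moreover have "{h. Inr (g, h) \<in> ?S} \<inter> pverts H = {} \<inter> pverts H"
      using Inr by auto
    ultimately show ?thesis
      using second_within_cong[OF local_to_dominates] by metis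
  qed
  \<comment> \<open>If \<open>v\<close> lay outside the copy, Dominator would win the S-game on
    \<open>H\<close>.\<close>
  have "{h. Inr (g, h) = v} \<inter> pverts H \<noteq> {}"
  proof
    assume "{h. Inr (g, h) = v} \<inter> pverts H = {}"
    moreover have "second_within (unit H g) (unit_won H g) k' (insert v D) ?S"
      by (rule second_within_component) (fact second sub won local_to_unit_won)+
    ultimately show False using copy[of k'] noS[of k'] by simp
  qed
  then obtain h where h: "h \<in> pverts H" "v = Inr (g, h)" by auto
  have other: "insert v D \<inter> unit H g' = D \<inter> unit H g'" "?S \<inter> unit H g' = S \<inter> unit H g'"
    if "g' \<noteq> g" for g'
    using that h(2) by (auto simp: unit_def)
  \<comment> \<open>\<open>g\<close> passes from \<open>F\<close> to \<open>E\<close>, and the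
    forced move \<open>v\<close> pays for the decrease of \<open>card F\<close>.\<close>
  have "card F + (card (F \<union> insert g E) + 1) div 2 * (a - 1)
      + card (F \<union> insert g E) div 2 * (domination_number H - 1) \<le> k'"
  proof (rule insert.IH)
    show "finite (insert g E)" "F \<inter> insert g E = {}" "F \<union> insert g E \<subseteq> pverts G"
      using insert.hyps insert.prems(1-3) by auto
    show "second_within ?V ?W k' (insert v D) ?S" by fact
    show "insert v D \<inter> unit H g' = {} \<and> ?S \<inter> unit H g' = {}" if "g' \<in> F" for g'
      using that insert.prems(5)[of g'] insert.hyps(2) other[of g'] by auto
    show "a - 1 \<le> m" if g': "g' \<in> insert g E"
      "second_within (unit H g') (unit_won H g') m (insert v D) ?S" for g' m
    proof (cases "g' = g")
      case True
      \<comment> \<open>The move \<open>h\<close> and \<open>m\<close> further ones win the D-game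
        on \<open>H\<close>, so \<open>m + 1\<close> is at least \<open>a\<close>.\<close>
      have "{h'. Inr (g, h') = v} \<inter> pverts H = {h}" using h by auto
      then have "second_within (pverts H) (dominates H) m {h} {}"
        using copy[of m] g'(2) True by simp
      then have "first_within (pverts H) (dominates H) (Suc m) {} {}"
        unfolding first_within_Suc using h(1) by auto
      then show ?thesis using a by fastforce
    next
      case False
      then have "second_within (unit H g') (unit_won H g') m D S"
        using g'(2) second_within_cong[OF local_to_unit_won other[OF False]] by blast
      then show ?thesis using insert.prems(6)[of g' m] g'(1) False by blast
    qed
    show "domination_number H - 1 \<le> card X"
      if X: "g' \<in> insert g E" "X \<subseteq> unit H g' - ?S" "finite X" "unit_won H g' (insert v D \<union> X)" for g' X
    proof (cases "g' = g")
      case True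
      have "Inl g \<notin> insert v D \<union> X" using v Inl X(2) by auto
      then obtain Y where Y: "dominating_set H Y" "Y \<subseteq> {h'. Inr (g, h') \<in> insert v D \<union> X}"
        using X(4) True unfolding unit_won_def dominates_def by auto
      \<comment> \<open>Apart from \<open>h\<close>, every vertex of the dominating set
        \<open>Y\<close> comes from \<open>X\<close>.\<close>
      have "Y \<subseteq> insert h ((\<lambda>h'. Inr (g, h')) -` X)"
        using Y Inr h(2) unfolding dominating_set_def by auto
      moreover have "finite ((\<lambda>h'. Inr (g, h')) -` X)"
        using X(3) by (rule finite_vimageI) (simp add: inj_on_def)
      ultimately have "card Y \<le> Suc (card ((\<lambda>h'. Inr (g, h')) -` X))"
        using card_mono[of "insert h ((\<lambda>h'. Inr (g, h')) -` X)" Y] by (simp add: card_insert_if split: if_splits)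
      moreover have "card ((\<lambda>h'. Inr (g, h')) -` X) \<le> card X"
        by (rule card_inj_on_le[of "\<lambda>h'. Inr (g, h')"]) (use X(3) in \<open>auto simp: inj_on_def\<close>)
      ultimately show ?thesis using domination_number_le[OF Y(1)] by linarith
    next
      case False
      have "(insert v D \<union> X) \<inter> unit H g' = (D \<union> X) \<inter> unit H g'"
        using other(1)[OF False] by blast
      then have "unit_won H g' (D \<union> X)"
        using X(4) local_to_unit_won[of H g'] unfolding local_to_def by blast
      then show ?thesis using insert.prems(7)[of g' X] X(1-3) False by blast
    qed
  qed
  moreover have "F \<union> insert g E = insert g F \<union> E" by blast
  ultimately show ?case using insert.hyps k by simp
qed

text \<open>\<open>D\<close> may contain moves outside the units of \<open>F\<close>, as in the
  D-game after Dominator's opening. The forced moves, one for each element of \<open>F\<close>,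
  restore the ones subtracted from \<open>a\<close> and from the domination number.\<close>

lemma second_within_corona_fresh_lower:
  assumes "finite (pverts H)" and "pverts H \<noteq> {}"
    and noS: "\<And>k. \<not> second_within (pverts H) (dominates H) k {} {}"
    and a: "\<And>k. first_within (pverts H) (dominates H) k {} {} \<Longrightarrow> a \<le> k" and "a \<ge> 1"
    and "finite F" and "F \<subseteq> pverts G"
    and "second_within (pverts (corona G H)) (dominates (corona G H)) k D {}"
    and "\<And>g. g \<in> F \<Longrightarrow> D \<inter> unit H g = {}"
  shows "card F div 2 * domination_number H + (card F + 1) div 2 * a \<le> k"
proof -
  have "\<not> dominates H {}" using noS second_within_won by blast
  then have \<gamma>: "domination_number H \<ge> 1"
    using assms(1) domination_number_pos by blast
  have "card F + (card (F \<union> {}) + 1) div 2 * (a - 1)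
      + card (F \<union> {}) div 2 * (domination_number H - 1) \<le> k"
    by (rule second_within_corona_lower[OF assms(1,2) noS a, where D = D and S = "{}" and G = G])
      (use assms(6-) in auto)
  moreover obtain a' \<gamma>' where "a = Suc a'" "domination_number H = Suc \<gamma>'"
    using \<gamma> assms(5) by (metis Suc_le_D One_nat_def)
  moreover have "card F = card F div 2 + (card F + 1) div 2" by simp
  ultimately show ?thesis by simp
qed

section \<open>The bounds for the D-game and the S-game on the corona\<close>

theorem theorem3p5:
  fixes G :: "'a pair_pre_digraph" and H :: "'b pair_pre_digraph"
  assumes "pair_graph G" and "pair_graph H"
    and "outcome_N H" and "order G \<ge> 2"
  shows "1 + enat ((order G - 1) div 2) * enat (domination_number H)
           + enat (order G div 2) * gamma_MB H \<le> gamma_MB (corona G H)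
       \<and> gamma_MB (corona G H) \<le> 1 + enat (order G - 1) * gamma_MB H
       \<and> enat (order G div 2) * enat (domination_number H)
           + enat ((order G + 1) div 2) * gamma_MB H \<le> gamma_MB' (corona G H)
       \<and> gamma_MB' (corona G H) \<le> enat (order G) * gamma_MB H"
proof -
  interpret G: pair_graph G by fact
  interpret H: pair_graph H by fact
  interpret C: pair_graph "corona G H" using assms(1,2) by (rule pair_graph_corona)
  let ?n = "order G" and ?\<gamma> = "domination_number H"
  let ?V = "pverts (corona G H)" and ?W = "dominates (corona G H)"
  note finG = G.pair_finite_verts and finH = H.pair_finite_verts and finC = C.pair_finite_verts
  note D_iff = wins_within_Dominator_iff[OF finH] wins_within_Dominator_iff[OF finC]
  note S_iff = wins_within_Staller_iff[OF finH] wins_within_Staller_iff[OF finC]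
  have noS: "\<not> second_within (pverts H) (dominates H) k {} {}" for k
    using assms(3) not_wins_within[OF finH, of Staller k] S_iff(1)[of k] unfolding outcome_N_def by blast
  then have not_dom: "\<not> dominates H {}" using second_within_won by blast
  then have neH: "pverts H \<noteq> {}" by (auto simp: dominates_def dominating_set_def)
  \<comment> \<open>The minimum exists because Dominator wins the D-game on \<open>H\<close>, so
    \<open>gamma_MB H\<close> is the finite number \<open>a\<close>.\<close>
  define a where "a = (LEAST k. wins_within H Dominator k)"
  have "wins_within H Dominator (card (pverts H))"
    using assms(3) wins_within_of_has_winning_strategy[OF finH] unfolding outcome_N_def by blast
  then have a_wins: "wins_within H Dominator a" and a_le: "\<And>k. wins_within H Dominator k \<Longrightarrow> a \<le> k"
    unfolding a_def by (auto intro: LeastI Least_le)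
  have a: "gamma_MB H = enat a"
    unfolding gamma_MB_def by (rule antisym) (use a_wins a_le in \<open>auto intro!: Inf_lower Inf_greatest\<close>)
  have a_first: "first_within (pverts H) (dominates H) a {} {}" using a_wins D_iff(1) by blast
  then have a1: "a \<ge> 1" using not_dom by (cases a) auto
  have G_ne: "pverts G \<noteq> {}" using assms(4) by (auto simp: order_def)

  have corona_won: "?W D" if "\<And>g. g \<in> pverts G \<Longrightarrow> unit_won H g D" for D
    using that dominates_corona_iff[OF neH, of G D] by simp
  note unit_upper = second_within_unit_upper[OF a_first a1]

  have "1 + (?n - 1) div 2 * ?\<gamma> + ?n div 2 * a \<le> k" if "wins_within (corona G H) Dominator k" for k
  proof -
    obtain g where g: "g \<in> pverts G" using G_ne by blast
    have "\<not> unit_won H g {}" using not_dom by (simp add: unit_won_def)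
    then have "\<not> ?W {}" using g dominates_corona_iff[OF neH, of G "{}"] by auto
    moreover have "first_within ?V ?W k {} {}" using that D_iff(2) by blast
    ultimately obtain k' v where k: "k = Suc k'" and "v \<in> ?V"
      and second: "second_within ?V ?W k' {v} {}"
      by (cases k) (auto simp: first_within_Suc simp del: first_within.simps(2))
    then obtain g where g: "g \<in> pverts G" "v \<in> unit H g" by (auto simp: pverts_corona)
    \<comment> \<open>The unit of the opening move is given up. The other \<open>?n - 1\<close>
      units are untouched with Staller to move; the opening itself is the summand 1.\<close>
    have "card (pverts G - {g}) div 2 * ?\<gamma> + (card (pverts G - {g}) + 1) div 2 * a \<le> k'"
    proof (rule second_within_corona_fresh_lower[OF finH neH noS _ a1 _ _ second])
      show "{v} \<inter> unit H g' = {}" if "g' \<in> pverts G - {g}" for g'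
        using that g(2) by (auto simp: unit_def)
    qed (use finG a_le D_iff(1) in auto)
    then show ?thesis
      using k g(1) assms(4) finG by (simp add: order_def)
  qed
  then have lower: "enat (1 + (?n - 1) div 2 * ?\<gamma> + ?n div 2 * a) \<le> gamma_MB (corona G H)"
    unfolding gamma_MB_def by (auto intro!: Inf_greatest)

  have "?n div 2 * ?\<gamma> + (?n + 1) div 2 * a \<le> k" if "wins_within (corona G H) Staller k" for k
    unfolding order_def
    by (rule second_within_corona_fresh_lower[OF finH neH noS _ a1, where G = G and D = "{}"])
      (use finG a_le D_iff(1) S_iff(2) that in auto)
  then have lower': "enat (?n div 2 * ?\<gamma> + (?n + 1) div 2 * a) \<le> gamma_MB' (corona G H)"
    unfolding gamma_MB'_def by (auto intro!: Inf_greatest)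

  obtain g where g: "g \<in> pverts G" using G_ne by blast
  \<comment> \<open>Dominator opens in the unit of \<open>g\<close>, which costs one move; each
    other unit has budget \<open>a\<close>.\<close>
  let ?k = "\<lambda>g'. if g' = g then 1 else a"
  have "first_within ?V ?W (sum ?k (pverts G)) {} {}"
  proof (rule first_within_sum[where B = "unit H" and W = "unit_won H"])
    show "first_within (unit H g) (unit_won H g) (?k g) {} {}"
      using first_within_unit_1[of g "{}" H] by simp
    show "second_within (unit H g') (unit_won H g') (?k g') {} {}" if "g' \<in> pverts G - {g}" for g'
      using that unit_upper by simp
  qed (use corona_won in \<open>auto simp: pverts_corona intro: finG disjoint_units local_to_unit_won g\<close>)
  moreover have "sum ?k (pverts G) = 1 + (?n - 1) * a"
    using g finG by (simp add: sum.remove[of _ g] order_def)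
  ultimately have "wins_within (corona G H) Dominator (1 + (?n - 1) * a)"
    using D_iff(2) by metis
  then have upper: "gamma_MB (corona G H) \<le> enat (1 + (?n - 1) * a)"
    unfolding gamma_MB_def by (blast intro: Inf_lower)

  have "second_within ?V ?W (\<Sum>g \<in> pverts G. a) {} {}"
    by (rule second_within_sum[where B = "unit H" and W = "unit_won H"])
      (use corona_won G_ne in \<open>auto simp: pverts_corona intro: finG disjoint_units local_to_unit_won unit_upper\<close>)
  then have upper': "gamma_MB' (corona G H) \<le> enat (?n * a)"
    unfolding gamma_MB'_def using S_iff(2) by (auto intro!: Inf_lower simp: order_def)

  show ?thesis
    using lower lower' upper upper' unfolding a by (simp add: one_enat_def)
qed

end
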